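(* We have $$n_0+R-1\le\mathcal{D}^22^{D-1}\le R^2D^22^{D-1}$$ and $$n_0+R-1\le(\mathcal{D}-1)2^{\mathcal{D}}.$$
   Context: Let $D\in\mathbb{N}$ and let $r_1,\dots,r_D$ be non-negative integers with $r_D\ge1$. Put $R=r_1+\dots+r_D$, $\Delta=\{d:r_d\ge1\}\subseteq\{1,\dots,D\}$, $\mathcal{D}_j=r_1+2r_2+\dots+jr_j$ for $1\le j\le D$, $\mathcal{D}_0=0$ and $\mathcal{D}=\mathcal{D}_D$. The number $n_0$ is defined by $$t_d=\sum_{k=d}^D2^{k-1}(k-1)r_k\quad(1\le d\le D+1),\qquad n_0(d)=\mathcal{D}_d\left(2^{d-1}+t_{d+1}\right)+t_{d+1}+\sum_{j=d+1}^Dt_jr_j,$$ $$n_0=\max\{n_0(d):d\in\Delta\cup\{0\}\},$$ with empty sums equal to $0$.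
   Formalization: The second inequality is asserted only for 𝒟 ≥ 2; the sole excluded case is D = 1, r_1 = 1, where n_0 = R = 1 and the printed inequality would read 1 ≤ 0, which is false. *)

theory Defs
  imports Main
begin

text \<open>
  The tuple \<open>r\<^sub>1, \<dots>, r\<^sub>D\<close> is a function \<open>r :: nat \<Rightarrow> nat\<close>, of which only the
  values at \<open>1, \<dots>, D\<close> are used.
\<close>

definition R_tot :: "nat \<Rightarrow> (nat \<Rightarrow> nat) \<Rightarrow> nat" where
  "R_tot D r = (\<Sum>d=1..D. r d)"

definition Delta :: "nat \<Rightarrow> (nat \<Rightarrow> nat) \<Rightarrow> nat set" where
  "Delta D r = {d \<in> {1..D}. r d \<ge> 1}"

definition Dsum :: "(nat \<Rightarrow> nat) \<Rightarrow> nat \<Rightarrow> nat" where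
  "Dsum r j = (\<Sum>k=1..j. k * r k)"

definition t :: "nat \<Rightarrow> (nat \<Rightarrow> nat) \<Rightarrow> nat \<Rightarrow> nat" where
  "t D r d = (\<Sum>k=d..D. 2 ^ (k - 1) * (k - 1) * r k)"

text \<open>
  At \<open>d = 0\<close> the truncated exponent \<open>d - 1\<close> is harmless: the power is multiplied
  by \<open>Dsum r 0 = 0\<close>.
\<close>

definition n0_at :: "nat \<Rightarrow> (nat \<Rightarrow> nat) \<Rightarrow> nat \<Rightarrow> nat" where
  "n0_at D r d =
     Dsum r d * (2 ^ (d - 1) + t D r (d + 1)) + t D r (d + 1) + (\<Sum>j=d+1..D. t D r j * r j)"

definition n0 :: "nat \<Rightarrow> (nat \<Rightarrow> nat) \<Rightarrow> nat" where
  "n0 D r = Max (n0_at D r ` (Delta D r \<union> {0}))"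

end

theory Submission
  imports Defs
begin

text \<open>
  Fix \<open>d \<le> D\<close> and split the total degree \<open>\<D> = Dsum r D\<close> as \<open>a + w + h\<close>: here
  \<open>a = Dsum r d\<close>, while \<open>h\<close> counts the indices above \<open>d\<close> with multiplicity \<open>r\<close>, and \<open>w\<close>
  is the sum of \<open>(k - 1) * r k\<close> over \<open>k > d\<close>. Replacing every power of two by
  \<open>P = 2 ^ (D - 1)\<close> bounds each \<open>t D r j\<close> with \<open>j > d\<close> by \<open>P * w\<close>, whence
  \<open>n0_at D r d \<le> P * (a + w * (a + h + 1))\<close>. Also \<open>R \<le> a + h\<close>.

  The quadratic bound follows, because \<open>(a + w + h)\<^sup>2\<close> exceeds
  \<open>a + w * (a + h + 1) + (a + h - 1)\<close> by
  \<open>(a - 1)\<^sup>2 + (w\<^sup>2 - w) + (h\<^sup>2 - h) + a * w + 2 * a * h + w * h\<close>.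

  For the exponential bound, put \<open>e = \<D> - D\<close>, so that
  \<open>(\<D> - 1) * 2 ^ \<D> = P * (\<D> - 1) * 2 ^ (e + 1)\<close>, and note \<open>2 ^ (e + 1) \<ge> e + 2\<close>.
  What remains is a comparison with \<open>P * (\<D> - 1) * (e + 2)\<close>. Since \<open>r D \<ge> 1\<close>, the part
  \<open>w\<close> contains the summand for \<open>k = D\<close> as soon as \<open>d < D\<close>, so \<open>w \<ge> D - 1\<close> and
  \<open>a + h \<le> e + 1\<close>: few indices can occur besides the largest one. The bound is sharp, with
  equality when \<open>D\<close> is the only index, taken once, and \<open>d = 0\<close>.
\<close>

lemma t_antimono: "i \<le> j \<Longrightarrow> t D r j \<le> t D r i"
  unfolding t_def by (rule sum_mono2) auto

lemma t_le_power_times_weight: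
  "t D r i \<le> 2 ^ (D - 1) * (\<Sum>k=i..D. (k - 1) * r k)"
  unfolding t_def sum_distrib_left
proof (rule sum_mono)
  fix k assume "k \<in> {i..D}"
  then have "(2::nat) ^ (k - 1) \<le> 2 ^ (D - 1)"
    by (intro power_increasing) auto
  then show "2 ^ (k - 1) * (k - 1) * r k \<le> 2 ^ (D - 1) * ((k - 1) * r k)"
    by simp
qed

lemma R_tot_le_Dsum: "R_tot D r \<le> Dsum r D"
  unfolding R_tot_def Dsum_def by (rule sum_mono) auto

lemma Dsum_le_R_tot_times: "Dsum r D \<le> R_tot D r * D"
  unfolding R_tot_def Dsum_def sum_distrib_right
  by (rule sum_mono) (auto simp: mult.commute)

lemma sum_weights_split:
  "1 \<le> i \<Longrightarrow> (\<Sum>k=i..D. k * r k) = (\<Sum>k=i..D. (k - 1) * r k) + (\<Sum>k=i..D. r k)"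
  for r :: "nat \<Rightarrow> nat"
proof -
  assume "1 \<le> i"
  then have "k * r k = (k - 1) * r k + r k" if "k \<in> {i..D}" for k
    using that by (cases k) auto
  then show ?thesis
    by (simp flip: sum.distrib)
qed

text \<open>
  The term with index \<open>D\<close> alone contributes \<open>D - 1\<close> to the difference between the total
  degree and the number of indices.
\<close>
lemma weight_ge_top:
  assumes "r D \<ge> 1" and "i \<le> D"
  shows "D \<le> (\<Sum>k=i..D. (k - 1) * r k) + (1::nat)"
proof -
  have "(D - 1) * r D \<le> (\<Sum>k=i..D. (k - 1) * r k)"
    by (rule member_le_sum) (use assms in auto)
  moreover have "D - 1 \<le> (D - 1) * r D"
    using assms by simp
  ultimately show ?thesis by linarith
qed

lemma R_tot_plus_top_le:
  assumes "D \<ge> 1" and "r D \<ge> 1"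
  shows "R_tot D r + D \<le> Dsum r D + 1"
  using sum_weights_split[of 1 r D] weight_ge_top[of r D 1] assms
  unfolding R_tot_def Dsum_def by linarith

text \<open>
  All that the two upper bounds use about \<open>n0_at\<close>. The numbers \<open>w\<close> and \<open>h\<close> are kept
  separate, so that no subtraction occurs; the final disjunction separates
  \<open>d < D\<close> from \<open>d = D\<close>, where the sums over indices above \<open>d\<close> are empty.
\<close>
lemma n0_at_estimate:
  assumes "d \<le> D" and "r D \<ge> 1"
  obtains a w h where
    "n0_at D r d \<le> 2 ^ (D - 1) * (a + w * (a + h + 1))"
    "Dsum r D = a + w + h"
    "R_tot D r \<le> a + h"
    "1 \<le> h \<and> D \<le> w + 1 \<or> w = 0 \<and> h = 0"
proof -
  define a where "a = Dsum r d"
  define w where "w = (\<Sum>k=d+1..D. (k - 1) * r k)"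
  define h where "h = (\<Sum>k=d+1..D. r k)"
  define P where "P = (2::nat) ^ (D - 1)"
  have interval: "{1..D} = {1..d} \<union> {d+1..D}"
    using assms(1) by auto
  have split: "(\<Sum>k=1..D. f k) = (\<Sum>k=1..d. f k) + (\<Sum>k=d+1..D. f k)" for f :: "nat \<Rightarrow> nat"
    unfolding interval by (rule sum.union_disjoint) auto
  have degree: "Dsum r D = a + w + h"
    using sum_weights_split[of "d+1" r D] split[of "\<lambda>k. k * r k"]
    by (simp add: Dsum_def a_def w_def h_def)
  have number: "R_tot D r \<le> a + h"
    using R_tot_le_Dsum[of d r] split[of r]
    by (simp add: R_tot_def a_def h_def)
  have t_le: "t D r (d + 1) \<le> P * w"
    using t_le_power_times_weight[of D r "d+1"] by (simp add: P_def w_def)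
  have "(\<Sum>j=d+1..D. t D r j * r j) \<le> (\<Sum>j=d+1..D. (P * w) * r j)"
    by (intro sum_mono mult_le_mono1 order_trans[OF t_antimono t_le]) auto
  then have tail: "(\<Sum>j=d+1..D. t D r j * r j) \<le> P * w * h"
    by (simp add: h_def sum_distrib_left)
  have "(2::nat) ^ (d - 1) \<le> P"
    unfolding P_def using assms(1) by (intro power_increasing) auto
  then have "a * (2 ^ (d - 1) + t D r (d + 1)) \<le> a * (P + P * w)"
    using t_le by (intro mult_le_mono2 add_mono)
  then have "n0_at D r d \<le> a * (P + P * w) + P * w + P * w * h"
    unfolding n0_at_def a_def[symmetric] using t_le tail by linarith
  also have "\<dots> = P * (a + w * (a + h + 1))"
    by (simp add: algebra_simps)
  finally have bound: "n0_at D r d \<le> P * (a + w * (a + h + 1))" .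
  have "1 \<le> h \<and> D \<le> w + 1 \<or> w = 0 \<and> h = 0"
  proof (cases "d < D")
    case True
    then have "r D \<le> h"
      unfolding h_def by (intro member_le_sum) auto
    moreover have "D \<le> w + 1"
      unfolding w_def using weight_ge_top[of r D "d+1"] assms(2) True by simp
    ultimately show ?thesis using assms(2) by simp
  next
    case False
    then show ?thesis using assms(1) by (simp add: w_def h_def)
  qed
  with that[of a w h] bound degree number show thesis
    unfolding P_def by blast
qed

lemma n0_attained:
  obtains d where "d \<le> D" and "n0 D r = n0_at D r d"
proof -
  have "finite (Delta D r \<union> {0})"
    by (simp add: Delta_def)
  then have "n0 D r \<in> n0_at D r ` (Delta D r \<union> {0})"
    unfolding n0_def by (intro Max_in) auto
  then show thesis
    using that by (auto simp: Delta_def)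
qed

lemma quadratic_comparison:
  fixes a w h :: int
  assumes "0 \<le> a" "0 \<le> w" "0 \<le> h"
  shows "a + w * (a + h + 1) + (a + h - 1) \<le> (a + w + h)\<^sup>2"
proof -
  have "0 \<le> (a - 1)\<^sup>2" "0 \<le> a * w" "0 \<le> a * h" "0 \<le> w * h"
    using assms by simp_all
  moreover have "w \<le> w\<^sup>2" "h \<le> h\<^sup>2"
    using assms self_le_power[of w 2] self_le_power[of h 2] by (cases "w = 0"; cases "h = 0"; simp)+
  ultimately show ?thesis
    by (simp add: power2_eq_square algebra_simps)
qed

text \<open>
  With \<open>c = a + h - 1\<close>, the condition \<open>1 \<le> h\<close> gives \<open>a \<le> c\<close>, so the left-hand side is at
  most \<open>(w + 2) * c + 2 * w\<close>, which is at most \<open>(w + c) * (e + 2)\<close> by \<open>c \<le> e\<close>.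
\<close>
lemma excess_comparison:
  fixes a w h e :: int
  assumes "0 \<le> a" "0 \<le> w" "1 \<le> h" "a + h \<le> e + 1"
  shows "a + w * (a + h + 1) + (a + h - 1) \<le> (a + w + h - 1) * (e + 2)"
proof -
  define c where "c = a + h - 1"
  have c: "0 \<le> c" "a \<le> c" "c \<le> e"
    using assms by (auto simp: c_def)
  have "w * c \<le> w * e" "0 \<le> c * e"
    using assms c by (auto intro: mult_left_mono)
  moreover have "a + w * (a + h + 1) + (a + h - 1) = a + w * c + 2 * w + c"
    "(a + w + h - 1) * (e + 2) = w * e + 2 * w + c * e + 2 * c"
    by (simp_all add: c_def algebra_simps)
  ultimately show ?thesis
    using c by linarith
qed

lemma n0_quadratic_bound:
  assumes "D \<ge> 1" and "r D \<ge> 1"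
  shows "int (n0 D r) + int (R_tot D r) - 1 \<le> int (Dsum r D) ^ 2 * 2 ^ (D - 1)"
proof -
  obtain d where d: "d \<le> D" "n0 D r = n0_at D r d"
    by (rule n0_attained)
  obtain a w h where est:
    "n0_at D r d \<le> 2 ^ (D - 1) * (a + w * (a + h + 1))"
    "Dsum r D = a + w + h" "R_tot D r \<le> a + h"
    using n0_at_estimate[of d D r] d(1) assms(2) by metis
  define P where "P = (2::int) ^ (D - 1)"
  have "r D \<le> R_tot D r"
    unfolding R_tot_def using assms(1) by (intro member_le_sum) auto
  then have "1 \<le> a + h"
    using est(3) assms(2) by linarith
  then have "1 * (int a + int h - 1) \<le> P * (int a + int h - 1)"
    unfolding P_def by (intro mult_right_mono) auto
  then have "int (R_tot D r) - 1 \<le> P * (int a + int h - 1)"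
    using est(3) by simp
  moreover have "int (n0 D r) \<le> P * (int a + int w * (int a + int h + 1))"
    using of_nat_mono[OF est(1), where ?'a = int] unfolding d(2) P_def by (simp add: algebra_simps)
  ultimately have "int (n0 D r) + int (R_tot D r) - 1
      \<le> P * (int a + int w * (int a + int h + 1) + (int a + int h - 1))"
    unfolding distrib_left[of P _ "int a + int h - 1"] by simp
  also have "\<dots> \<le> P * (int a + int w + int h)\<^sup>2"
    using quadratic_comparison[of "int a" "int w" "int h"]
    by (intro mult_left_mono) (auto simp: P_def)
  finally show ?thesis
    by (simp add: est(2) P_def mult.commute)
qed

lemma n0_exponential_bound:
  assumes "D \<ge> 1" and "r D \<ge> 1" and "Dsum r D \<ge> 2"
  shows "int (n0 D r) + int (R_tot D r) - 1 \<le> (int (Dsum r D) - 1) * 2 ^ Dsum r D"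
proof -
  obtain d where d: "d \<le> D" "n0 D r = n0_at D r d"
    by (rule n0_attained)
  obtain a w h where est:
    "n0_at D r d \<le> 2 ^ (D - 1) * (a + w * (a + h + 1))"
    "Dsum r D = a + w + h" "R_tot D r \<le> a + h"
    "1 \<le> h \<and> D \<le> w + 1 \<or> w = 0 \<and> h = 0"
    using n0_at_estimate[of d D r] d(1) assms(2) by metis
  define P where "P = (2::int) ^ (D - 1)"
  have P: "1 \<le> P"
    by (simp add: P_def)
  have R_pos: "1 \<le> R_tot D r"
    using member_le_sum[of D "{1..D}" r] assms(1,2) unfolding R_tot_def by simp
  have top: "R_tot D r + D \<le> Dsum r D + 1"
    using R_tot_plus_top_le assms(1,2) .
  define e where "e = Dsum r D - D"
  have e: "Dsum r D = D + e"
    using top R_pos by (simp add: e_def)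
  have n: "int (n0 D r) \<le> P * (int a + int w * (int a + int h + 1))"
    using of_nat_mono[OF est(1), where ?'a = int] unfolding d(2) P_def by (simp add: algebra_simps)
  have "int (R_tot D r) - 1 \<le> P * (int (R_tot D r) - 1)"
    using P R_pos mult_right_mono[of 1 P "int (R_tot D r) - 1"] by simp
  with n have "int (n0 D r) + int (R_tot D r) - 1
      \<le> P * (int a + int w * (int a + int h + 1) + (int (R_tot D r) - 1))"
    by (simp add: distrib_left)
  also have "\<dots> \<le> P * ((int (Dsum r D) - 1) * (int e + 2))"
  proof (rule mult_left_mono)
    show "int a + int w * (int a + int h + 1) + (int (R_tot D r) - 1)
        \<le> (int (Dsum r D) - 1) * (int e + 2)"
    proof (cases "1 \<le> h \<and> D \<le> w + 1")
      case True
      then have "int a + int h \<le> int e + 1"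
        using e est(2) by linarith
      then show ?thesis
        using excess_comparison[of "int a" "int w" "int h" "int e"] True est(2,3) by simp
    next
      case False
      then have empty: "w = 0" "h = 0" "a = Dsum r D"
        using est(2,4) by auto
      \<comment> \<open>Here \<open>R \<le> a + h\<close> is too weak; the bound \<open>R - 1 \<le> e\<close> replaces it.\<close>
      have "1 * int e \<le> (int a - 1) * int e"
        using assms(3) empty by (intro mult_right_mono) auto
      moreover have "(int a - 1) * (int e + 2) = (int a - 1) * int e + 2 * (int a - 1)"
        by (simp add: algebra_simps)
      moreover have "int (R_tot D r) - 1 \<le> int e"
        using top e by linarith
      moreover have "2 \<le> int a"
        using assms(3) empty by simp
      ultimately show ?thesis
        unfolding empty(1,2) empty(3)[symmetric] by simp
    qed
  qed (use P in simp)
  also have "\<dots> \<le> P * ((int (Dsum r D) - 1) * 2 ^ (e + 1))"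
  proof -
    have "int e + 2 \<le> 2 ^ (e + 1)"
      by (induction e) auto
    then show ?thesis
      using P assms(3) by (intro mult_left_mono) auto
  qed
  also have "\<dots> = (int (Dsum r D) - 1) * 2 ^ Dsum r D"
  proof -
    have "Dsum r D = (D - 1) + (e + 1)"
      using e assms(1) by simp
    then have "(2::int) ^ Dsum r D = P * 2 ^ (e + 1)"
      unfolding P_def by (metis power_add)
    then show ?thesis by simp
  qed
  finally show ?thesis .
qed

theorem theorem1p6:
  fixes D :: nat and r :: "nat \<Rightarrow> nat"
  assumes "D \<ge> 1" and "r D \<ge> 1"
  shows "int (n0 D r) + int (R_tot D r) - 1 \<le> int (Dsum r D) ^ 2 * 2 ^ (D - 1)
       \<and> int (Dsum r D) ^ 2 * 2 ^ (D - 1) \<le> int (R_tot D r) ^ 2 * int D ^ 2 * 2 ^ (D - 1)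
       \<and> (Dsum r D \<ge> 2 \<longrightarrow>
            int (n0 D r) + int (R_tot D r) - 1 \<le> (int (Dsum r D) - 1) * 2 ^ Dsum r D)"
proof (intro conjI impI)
  have "int (Dsum r D) \<le> int (R_tot D r) * int D"
    using Dsum_le_R_tot_times[of r D] by (metis of_nat_le_iff of_nat_mult)
  then have "int (Dsum r D) ^ 2 \<le> (int (R_tot D r) * int D) ^ 2"
    by (intro power_mono) auto
  then show "int (Dsum r D) ^ 2 * 2 ^ (D - 1) \<le> int (R_tot D r) ^ 2 * int D ^ 2 * 2 ^ (D - 1)"
    by (simp add: power_mult_distrib)
qed (use n0_quadratic_bound n0_exponential_bound assms in blast)+

end
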